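(* Let $\mathbf{V}$ and $\widetilde{\mathbf{E}}$ be vector spaces and $\mathbf{E}\subseteq\mathbf{V}$ a subspace; let $\|\cdot\|_{\mathbf{E}}$ and $\|\cdot\|_{\widetilde{\mathbf{E}}}$ be norms on $\mathbf{E}$ and $\widetilde{\mathbf{E}}$, with open-ball $\sigma$-algebras $\mathcal{B}^\circ$ and $\widetilde{\mathcal{B}}^\circ$. Let $\overline{\widetilde{\mathcal{B}}^\circ}$ be the $\sigma$-algebra on $\widetilde{\mathbf{E}}\times\widetilde{\mathbf{E}}$ generated by the open balls with respect to the metric $((\widetilde x_1,\widetilde x_2),(\widetilde y_1,\widetilde y_2))\mapsto\max\{\|\widetilde x_1-\widetilde y_1\|_{\widetilde{\mathbf{E}}},\|\widetilde x_2-\widetilde y_2\|_{\widetilde{\mathbf{E}}}\}$. Let $H:\mathbf{V}_H\to\widetilde{\mathbf{E}}$ be a map defined on some $\mathbf{V}_H\subseteq\mathbf{V}$, and $x\in\mathbf{V}_H$. Let $\mathbf{E}_0\in\mathcal{B}^\circ$ be a $\|\cdot\|_{\mathbf{E}}$-separable subset of $\mathbf{E}$. For every $n\in\mathbb{N}$ let $(\Omega_n,\mathcal{F}_n,\mathbb{P}_n)$ be a probability space and $X_n:\Omega_n\to\mathbf{V}$ any map. Let $(a_n)$ be a sequence of positive real numbers tending to $\infty$, and consider the following conditions (for every $n\in\mathbb{N}$ where applicable): (a) $X_n$ takes values only in $\mathbf{V}_H$. (b) $a_n(X_n-x)$ takes values only in $\mathbf{E}$, is $(\mathcal{F}_n,\mathcal{B}^\circ)$-measurable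 and satisfies $a_n(X_n-x)\leadsto^\circ X_0$ in $(\mathbf{E},\mathcal{B}^\circ,\|\cdot\|_{\mathbf{E}})$ for some $(\mathbf{E},\mathcal{B}^\circ)$-valued random variable $X_0$ on some probability space $(\Omega_0,\mathcal{F}_0,\mathbb{P}_0)$ with $X_0(\Omega_0)\subseteq\mathbf{E}_0$. (c) $a_n(H(X_n)-H(x))$ is $(\mathcal{F}_n,\widetilde{\mathcal{B}}^\circ)$-measurable. (d) $H$ is quasi-Hadamard differentiable at $x$ tangentially to $\mathbf{E}_0\langle\mathbf{E}\rangle$ with quasi-Hadamard derivative $\dot H_x:\mathbf{E}_0\to\widetilde{\mathbf{E}}$. (e) $(\Omega_n,\mathcal{F}_n,\mathbb{P}_n)=(\Omega,\mathcal{F},\mathbb{P})$ for all $n\in\mathbb{N}$. (f) $\dot H_x$ can be extended to $\mathbf{E}$ such that the extension $\dot H_x:\mathbf{E}\to\widetilde{\mathbf{E}}$ is continuous at every point of $\mathbf{E}_0$ and $(\mathcal{B}^\circ,\widetilde{\mathcal{B}}^\circ)$-measurable. (g) The map $h:\widetilde{\mathbf{E}}\times\widetilde{\mathbf{E}}\to\widetilde{\mathbf{E}}$, $h(\widetilde x_1,\widetilde x_2):=\widetilde x_1-\widetilde x_2$, is $(\overline{\widetilde{\mathcal{B}}^\circ},\widetilde{\mathcal{B}}^\circ)$-measurable. Then: (i) If (a)--(d) hold, then $\dot H_x(X_0)$ is $(\mathcal{F}_0,\widetilde{\mathcal{B}}^\circ)$-measurable and $a_n(H(X_n)-H(x))\leadsto^\circ\dot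 H_x(X_0)$ in $(\widetilde{\mathbf{E}},\widetilde{\mathcal{B}}^\circ,\|\cdot\|_{\widetilde{\mathbf{E}}})$. (ii) If (a)--(g) hold, then $a_n(H(X_n)-H(x))-\dot H_x(a_n(X_n-x))\to^{\mathsf{p},\circ}0_{\widetilde{\mathbf{E}}}$ in $(\widetilde{\mathbf{E}},\|\cdot\|_{\widetilde{\mathbf{E}}})$, where $0_{\widetilde{\mathbf E}}$ is the null of $\widetilde{\mathbf{E}}$.
   Context: For a metric space $(\mathbf{E},d)$, the open-ball $\sigma$-algebra $\mathcal{B}^\circ$ is the $\sigma$-algebra generated by the open balls. For $(\mathbf{E},\mathcal{B}^\circ)$-valued random variables $Y_n$ (possibly on different probability spaces), $Y_n\leadsto^\circ Y_0$ means $\int g\,d\,\mathrm{law}\{Y_n\}\to\int g\,d\,\mathrm{law}\{Y_0\}$ for every bounded, continuous, $(\mathcal{B}^\circ,\mathcal{B}(\mathbb{R}))$-measurable $g:\mathbf{E}\to\mathbb{R}$. If all $Y_n$, $n\in\mathbb{N}_0$, are defined on the same probability space $(\Omega,\mathcal{F},\mathbb{P})$, $Y_n\to^{\mathsf{p},\circ}Y_0$ means that the maps $\omega\mapsto d(Y_n(\omega),Y_0(\omega))$ are $(\mathcal{F},\mathcal{B}(\mathbb{R}_+))$-measurable and $\lim_{n\to\infty}\mathbb{P}[d(Y_n,Y_0)\ge\varepsilon]=0$ for all $\varepsilon>0$. Quasi-Hadamard differentiability: for $\mathbf{E}_0\subseteq\mathbf{E}$, $H:\mathbf{V}_H\to\widetilde{\mathbf{E}}$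 is quasi-Hadamard differentiable at $x\in\mathbf{V}_H$ tangentially to $\mathbf{E}_0\langle\mathbf{E}\rangle$ if there is a continuous map $\dot H_x:\mathbf{E}_0\to\widetilde{\mathbf{E}}$ (the quasi-Hadamard derivative) such that $\lim_{n\to\infty}\|\dot H_x(x_0)-\varepsilon_n^{-1}(H(x+\varepsilon_nx_n)-H(x))\|_{\widetilde{\mathbf{E}}}=0$ for each triplet $(x_0,(x_n),(\varepsilon_n))$ with $x_0\in\mathbf{E}_0$, $(x_n)\subseteq\mathbf{E}$, $\|x_n-x_0\|_{\mathbf{E}}\to0$, $(x+\varepsilon_nx_n)\subseteq\mathbf{V}_H$, $(\varepsilon_n)\subset(0,\infty)$, $\varepsilon_n\to0$. *)

theory Defs
  imports "HOL-Probability.Probability"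
begin

section \<open>Norms on subspaces and the metrics involved\<close>

definition norm_on_subspace :: "'v::real_vector set \<Rightarrow> ('v \<Rightarrow> real) \<Rightarrow> bool" where
  "norm_on_subspace E N \<longleftrightarrow>
     subspace E \<and>
     (\<forall>x\<in>E. 0 \<le> N x) \<and>
     (\<forall>x\<in>E. N x = 0 \<longleftrightarrow> x = 0) \<and>
     (\<forall>x\<in>E. \<forall>c. N (c *\<^sub>R x) = \<bar>c\<bar> * N x) \<and>
     (\<forall>x\<in>E. \<forall>y\<in>E. N (x + y) \<le> N x + N y)"

text \<open>The values of \<open>N\<close> outside \<open>E\<close> are unconstrained, whereas the library requires the distance
  function of a metric to be nonnegative and symmetric on the whole type; hence the cut-off.\<close>

definition subspace_metric :: "'v::real_vector set \<Rightarrow> ('v \<Rightarrow> real) \<Rightarrow> 'v metric" where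
  "subspace_metric E N = metric (E, \<lambda>x y. if x \<in> E \<and> y \<in> E then N (x - y) else 0)"

lemma Metric_space_subspace:
  assumes "norm_on_subspace E N"
  shows "Metric_space E (\<lambda>x y. if x \<in> E \<and> y \<in> E then N (x - y) else 0)"
proof -
  have sub: "subspace E" using assms by (simp add: norm_on_subspace_def)
  have diff: "x - y \<in> E" if "x \<in> E" "y \<in> E" for x y
    using sub that by (rule subspace_diff)
  have comm: "N (x - y) = N (y - x)" if "x \<in> E" "y \<in> E" for x y
  proof -
    have "N ((-1) *\<^sub>R (y - x)) = \<bar>-1\<bar> * N (y - x)"
      using assms diff[OF that(2,1)] unfolding norm_on_subspace_def by blast
    then show ?thesis by simp
  qed
  have tri: "N (x - z) \<le> N (x - y) + N (y - z)" if "x \<in> E" "y \<in> E" "z \<in> E" for x y z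
  proof -
    have "N ((x - y) + (y - z)) \<le> N (x - y) + N (y - z)"
      using assms diff[OF that(1,2)] diff[OF that(2,3)] unfolding norm_on_subspace_def by blast
    then show ?thesis by simp
  qed
  show ?thesis
  proof
    fix x y
    show "0 \<le> (if x \<in> E \<and> y \<in> E then N (x - y) else 0)"
      using assms diff by (auto simp: norm_on_subspace_def)
    show "(if x \<in> E \<and> y \<in> E then N (x - y) else 0) = (if y \<in> E \<and> x \<in> E then N (y - x) else 0)"
      using comm by auto
  next
    fix x y assume "x \<in> E" "y \<in> E"
    then show "((if x \<in> E \<and> y \<in> E then N (x - y) else 0) = 0) = (x = y)"
      using assms diff[of x y] by (auto simp: norm_on_subspace_def)
  next
    fix x y z assume "x \<in> E" "y \<in> E" "z \<in> E"
    then show "(if x \<in> E \<and> z \<in> E then N (x - z) else 0)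
      \<le> (if x \<in> E \<and> y \<in> E then N (x - y) else 0) + (if y \<in> E \<and> z \<in> E then N (y - z) else 0)"
      using tri by simp
  qed
qed

lemma mspace_subspace_metric:
  "norm_on_subspace E N \<Longrightarrow> mspace (subspace_metric E N) = E"
  by (simp add: subspace_metric_def Metric_space.mspace_metric Metric_space_subspace)

lemma mdist_subspace_metric:
  "\<lbrakk>norm_on_subspace E N; x \<in> E; y \<in> E\<rbrakk> \<Longrightarrow> mdist (subspace_metric E N) x y = N (x - y)"
  by (simp add: subspace_metric_def Metric_space.mdist_metric Metric_space_subspace)

definition max_metric :: "('w::metric_space \<times> 'w) metric" where
  "max_metric = metric (UNIV, \<lambda>(x1, x2) (y1, y2). max (dist x1 y1) (dist x2 y2))"

lemma Metric_space_max:
  "Metric_space UNIV (\<lambda>(x1, x2) (y1, y2).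
     max (dist (x1::'w::metric_space) y1) (dist (x2::'w) y2))"
proof
  fix p q r :: "'w \<times> 'w"
  show "0 \<le> (case p of (x1, x2) \<Rightarrow> \<lambda>(y1, y2). max (dist x1 y1) (dist x2 y2)) q"
    by (auto simp: le_max_iff_disj split: prod.splits)
  show "(case p of (x1, x2) \<Rightarrow> \<lambda>(y1, y2). max (dist x1 y1) (dist x2 y2)) q
      = (case q of (x1, x2) \<Rightarrow> \<lambda>(y1, y2). max (dist x1 y1) (dist x2 y2)) p"
    by (auto simp: dist_commute split: prod.splits)
  show "((case p of (x1, x2) \<Rightarrow> \<lambda>(y1, y2). max (dist x1 y1) (dist x2 y2)) q = 0) = (p = q)"
    by (cases p; cases q) (smt (verit) Pair_inject case_prod_conv dist_eq_0_iff zero_le_dist)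
  show "(case p of (x1, x2) \<Rightarrow> \<lambda>(y1, y2). max (dist x1 y1) (dist x2 y2)) r
      \<le> (case p of (x1, x2) \<Rightarrow> \<lambda>(y1, y2). max (dist x1 y1) (dist x2 y2)) q
        + (case q of (x1, x2) \<Rightarrow> \<lambda>(y1, y2). max (dist x1 y1) (dist x2 y2)) r"
    by (cases p; cases q; cases r) (smt (verit) case_prod_conv dist_triangle)
qed

lemma mspace_max_metric: "mspace max_metric = UNIV"
  by (simp add: max_metric_def Metric_space.mspace_metric Metric_space_max)

lemma mdist_max_metric: "mdist max_metric (x1, x2) (y1, y2) = max (dist x1 y1) (dist x2 y2)"
  by (simp add: max_metric_def Metric_space.mdist_metric Metric_space_max)


section \<open>The open-ball sigma-algebra and the associated modes of convergence\<close>

definition open_ball_algebra :: "'a metric \<Rightarrow> 'a measure" where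
  "open_ball_algebra m = sigma (mspace m) {mball_of m x r | x r. x \<in> mspace m \<and> 0 < r}"

lemma space_open_ball_algebra: "space (open_ball_algebra m) = mspace m"
  by (simp add: open_ball_algebra_def space_measure_of_conv)

lemma sets_open_ball_algebra:
  "sets (open_ball_algebra m) =
     sigma_sets (mspace m) {mball_of m x r | x r. x \<in> mspace m \<and> 0 < r}"
  unfolding open_ball_algebra_def by (rule sets_measure_of) (auto simp: mball_of_def Metric_space.mball_def[OF Metric_space_mspace_mdist])

text \<open>The underlying spaces \<open>M n\<close> may differ from one another and from the space \<open>M0\<close> of the
  limit. Being a random variable with values in the open-ball sigma-algebra is part of both notions
  of convergence.\<close>

definition weak_conv_open_ball ::
  "'a metric \<Rightarrow> (nat \<Rightarrow> 'o measure) \<Rightarrow> (nat \<Rightarrow> 'o \<Rightarrow> 'a) \<Rightarrow> 'p measure \<Rightarrow> ('p \<Rightarrow> 'a) \<Rightarrow> bool" where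
  "weak_conv_open_ball m M Y M0 Y0 \<longleftrightarrow>
     (\<forall>n. Y n \<in> M n \<rightarrow>\<^sub>M open_ball_algebra m) \<and>
     Y0 \<in> M0 \<rightarrow>\<^sub>M open_ball_algebra m \<and>
     (\<forall>g :: 'a \<Rightarrow> real.
        continuous_map (mtopology_of m) euclideanreal g \<longrightarrow>
        bounded (g ` mspace m) \<longrightarrow>
        g \<in> open_ball_algebra m \<rightarrow>\<^sub>M borel \<longrightarrow>
        (\<lambda>n. \<integral>y. g y \<partial>distr (M n) (open_ball_algebra m) (Y n))
          \<longlonglongrightarrow> (\<integral>y. g y \<partial>distr M0 (open_ball_algebra m) Y0))"

definition conv_in_prob_open_ball ::
  "'a metric \<Rightarrow> 'o measure \<Rightarrow> (nat \<Rightarrow> 'o \<Rightarrow> 'a) \<Rightarrow> ('o \<Rightarrow> 'a) \<Rightarrow> bool" where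
  "conv_in_prob_open_ball m P Y Y0 \<longleftrightarrow>
     (\<forall>n. Y n \<in> P \<rightarrow>\<^sub>M open_ball_algebra m) \<and>
     Y0 \<in> P \<rightarrow>\<^sub>M open_ball_algebra m \<and>
     (\<forall>n. (\<lambda>\<omega>. mdist m (Y n \<omega>) (Y0 \<omega>)) \<in> P \<rightarrow>\<^sub>M restrict_space borel {0..}) \<and>
     (\<forall>\<epsilon>>0. (\<lambda>n. measure P {\<omega> \<in> space P. mdist m (Y n \<omega>) (Y0 \<omega>) \<ge> \<epsilon>}) \<longlonglongrightarrow> 0)"


section \<open>Quasi-Hadamard differentiability\<close>

text \<open>\<open>Hd\<close> is the derivative at \<open>x\<close>, tangentially to \<open>E0\<close> inside \<open>(E, N)\<close>, of the map \<open>H\<close> with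
  domain \<open>VH\<close>. Only the values of \<open>H\<close> on \<open>VH\<close> and of \<open>Hd\<close> on \<open>E0\<close> are relevant.\<close>

definition has_quasi_hadamard_derivative ::
  "'v::real_vector set \<Rightarrow> ('v \<Rightarrow> real) \<Rightarrow> 'v set \<Rightarrow> ('v \<Rightarrow> 'w::real_normed_vector) \<Rightarrow> 'v \<Rightarrow> 'v set
     \<Rightarrow> ('v \<Rightarrow> 'w) \<Rightarrow> bool" where
  "has_quasi_hadamard_derivative E N VH H x E0 Hd \<longleftrightarrow>
     continuous_map (subtopology (mtopology_of (subspace_metric E N)) E0) euclidean Hd \<and>
     (\<forall>x0 xs \<epsilon>.
        x0 \<in> E0 \<longrightarrow>
        (\<forall>n. xs n \<in> E) \<longrightarrow>
        (\<lambda>n::nat. N (xs n - x0)) \<longlonglongrightarrow> 0 \<longrightarrow>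
        (\<forall>n. x + \<epsilon> n *\<^sub>R xs n \<in> VH) \<longrightarrow>
        (\<forall>n. 0 < \<epsilon> n) \<longrightarrow>
        \<epsilon> \<longlonglongrightarrow> 0 \<longrightarrow>
        (\<lambda>n. norm (Hd x0 - inverse (\<epsilon> n) *\<^sub>R (H (x + \<epsilon> n *\<^sub>R xs n) - H x))) \<longlonglongrightarrow> 0)"

end

theory Submission
  imports Defs
begin

text \<open>No almost sure representation is used. Let \<open>F n\<close> be uniformly bounded random variables that are
  close to \<open>f y\<close> whenever \<open>n\<close> is large and \<open>Y n\<close> is close to \<open>y\<close>, locally at every point \<open>y\<close> of a
  separable set \<open>S\<close> carrying the limit \<open>Y0\<close>. Countably many balls on which the closeness is uniform
  cover \<open>S\<close>, and the distances to their centres yield continuous weights that are measurable for the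
  open-ball sigma-algebra. Finitely many of these weights have total mass close to one under \<open>Y0\<close>,
  hence eventually under \<open>Y n\<close>, so weak convergence gives \<open>E (F n) \<longrightarrow> E (f Y0)\<close>. Only \<open>F n\<close>, and not
  the maps \<open>y \<mapsto> a n (H (x + y / a n) - H x)\<close>, has to be measurable. Part (i) is the case
  \<open>F n = g (a n (H (X n) - H x))\<close>, and part (ii) the case where \<open>F n\<close> is the indicator of the event
  that the remainder exceeds \<open>\<epsilon>\<close> and \<open>f = 0\<close>.\<close>

section \<open>Separable sets and measurability for the open-ball sigma-algebra\<close>

text \<open>A Lindeloef argument that keeps the centres inside \<open>T\<close>, although a
  countable dense subset of \<open>S\<close> may miss \<open>T\<close>. Each pair of a dense point
  and a resolution that some point of \<open>T\<close> matches selects one such point, and there are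
  only countably many pairs.\<close>

lemma separable_ball_cover:
  assumes sep: "separable_space (subtopology (mtopology_of m) S)" and S: "S \<subseteq> mspace m"
    and T: "T \<subseteq> S" and pos: "\<And>y. y \<in> T \<Longrightarrow> 0 < \<delta> y"
  obtains C where "countable C" "C \<subseteq> T" "T \<subseteq> (\<Union>y\<in>C. mball_of m y (\<delta> y))"
proof -
  interpret Metric_space "mspace m" "mdist m" by (rule Metric_space_mspace_mdist)
  obtain D where D: "countable D" "D \<subseteq> S"
    and dense: "subtopology (mtopology_of m) S closure_of D = S"
    using sep S unfolding separable_space_def by (auto simp: inf_absorb2[OF S])
  define r where "r n = 1 / real (Suc n)" for n
  \<comment> \<open>The factor 2 pays for the triangle inequality: the selected point and the point
    to be covered both lie within \<open>r (snd p)\<close> of \<open>fst p\<close>.\<close>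
  define Q where "Q p y \<longleftrightarrow> y \<in> T \<and> mdist m y (fst p) < r (snd p) \<and> 2 * r (snd p) \<le> \<delta> y" for p y
  define A where "A = {p \<in> D \<times> UNIV. \<exists>y. Q p y}"
  define pick where "pick p = (SOME y. Q p y)" for p
  have pick: "Q p (pick p)" if "p \<in> A" for p
    using that unfolding A_def pick_def by (auto intro: someI)
  show ?thesis
  proof
    have "countable (D \<times> (UNIV::nat set))" using D(1) by blast
    then show "countable (pick ` A)"
      unfolding A_def by (intro countable_image) (auto intro: countable_subset[rotated])
    show "pick ` A \<subseteq> T" using pick by (auto simp: Q_def)
    show "T \<subseteq> (\<Union>y\<in>pick ` A. mball_of m y (\<delta> y))"
    proof
      fix z assume z: "z \<in> T"
      then have zS: "z \<in> S" and zm: "z \<in> mspace m" using T S by auto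
      obtain n where "1 / real (Suc n) < \<delta> z / 2"
        using pos[OF z] nat_approx_posE[of "\<delta> z / 2"] by auto
      then have n: "2 * r n \<le> \<delta> z" by (simp add: r_def)
      have "openin (subtopology (mtopology_of m) S) (S \<inter> mball_of m z (r n))"
        by (simp add: openin_subtopology_Int2 mtopology_of_def mball_of_def)
      moreover have "z \<in> S \<inter> mball_of m z (r n)" using zS zm by (simp add: r_def)
      moreover have "z \<in> subtopology (mtopology_of m) S closure_of D" using dense zS by simp
      ultimately obtain c where "c \<in> D" "c \<in> S \<inter> mball_of m z (r n)"
        unfolding in_closure_of by blast
      then have c: "c \<in> D" "mdist m z c < r n" by auto
      then have Qz: "Q (c, n) z" using z n by (simp add: Q_def)
      then have cn: "(c, n) \<in> A" using c by (auto simp: A_def)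
      let ?y = "pick (c, n)"
      have y: "?y \<in> T" "mdist m ?y c < r n" "2 * r n \<le> \<delta> ?y"
        using pick[OF cn] by (auto simp: Q_def)
      have "c \<in> mspace m" "?y \<in> mspace m" using c D S T y by auto
      then have "mdist m ?y z \<le> mdist m ?y c + mdist m z c"
        using zm triangle commute by metis
      then have "z \<in> mball_of m ?y (\<delta> ?y)" using c y zm \<open>?y \<in> mspace m\<close> by simp
      then show "z \<in> (\<Union>y\<in>pick ` A. mball_of m y (\<delta> y))" using cn by blast
    qed
  qed
qed

lemma mball_of_in_open_ball_algebra:
  "y \<in> mspace m \<Longrightarrow> mball_of m y r \<in> sets (open_ball_algebra m)"
proof (cases "0 < r")
  case False
  interpret Metric_space "mspace m" "mdist m" by (rule Metric_space_mspace_mdist)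
  show ?thesis using False mball_eq_empty[of y r] by (simp add: mball_of_def)
qed (auto simp: sets_open_ball_algebra)

text \<open>Continuity alone does not give measurability for the open-ball sigma-algebra, but the
  strict sublevel sets of a distance function are balls. Distances are therefore the building blocks
  of all test functions below.\<close>

lemma measurable_mdist_open_ball_algebra:
  assumes "y \<in> mspace m"
  shows "mdist m y \<in> borel_measurable (open_ball_algebra m)"
proof (rule borel_measurableI_less)
  fix r
  have "{z \<in> space (open_ball_algebra m). mdist m y z < r} = mball_of m y r"
    using assms by (auto simp: space_open_ball_algebra)
  then show "{z \<in> space (open_ball_algebra m). mdist m y z < r} \<in> sets (open_ball_algebra m)"
    using mball_of_in_open_ball_algebra[OF assms] by simp
qed

lemma measurable_open_ball_algebraI:
  assumes "f \<in> space P \<rightarrow> mspace m"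
    and "\<And>y r. y \<in> mspace m \<Longrightarrow> f -` mball_of m y r \<inter> space P \<in> sets P"
  shows "f \<in> P \<rightarrow>\<^sub>M open_ball_algebra m"
  unfolding open_ball_algebra_def
  by (rule measurable_measure_of) (use assms in auto)

text \<open>A relatively open subset of a separable \<open>S\<close> is the trace on
  \<open>S\<close> of countably many balls. The balls may stick out of \<open>S\<close>, so
  measurability of \<open>S\<close> itself is used to cut them back.\<close>

lemma continuous_on_separable_measurable:
  fixes f :: "'a \<Rightarrow> 'b::topological_space"
  assumes sep: "separable_space (subtopology (mtopology_of m) S)"
    and S: "S \<in> sets (open_ball_algebra m)"
    and f: "continuous_map (subtopology (mtopology_of m) S) euclidean f"
  shows "f \<in> borel_measurable (restrict_space (open_ball_algebra m) S)"
proof (rule borel_measurableI)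
  interpret Metric_space "mspace m" "mdist m" by (rule Metric_space_mspace_mdist)
  have Sm: "S \<subseteq> mspace m" using sets.sets_into_space[OF S] by (simp add: space_open_ball_algebra)
  fix U :: "'b set" assume "open U"
  then have "openin (subtopology (mtopology_of m) S) {z \<in> S. f z \<in> U}"
    using openin_continuous_map_preimage[OF f, of U] Sm by (simp add: inf_absorb2)
  then obtain V where V: "openin (mtopology_of m) V" "{z \<in> S. f z \<in> U} = V \<inter> S"
    by (auto simp: openin_subtopology)
  have "\<exists>r>0. mball_of m y r \<subseteq> V" if "y \<in> V" for y
    using V(1) that by (auto simp: mtopology_of_def openin_mtopology mball_of_def)
  then obtain \<delta> where \<delta>: "\<And>y. y \<in> V \<Longrightarrow> 0 < \<delta> y" "\<And>y. y \<in> V \<Longrightarrow> mball_of m y (\<delta> y) \<subseteq> V"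
    by metis
  obtain C where C: "countable C" "C \<subseteq> V \<inter> S" "V \<inter> S \<subseteq> (\<Union>y\<in>C. mball_of m y (\<delta> y))"
    using separable_ball_cover[OF sep Sm, of "V \<inter> S" \<delta>] \<delta>(1) by blast
  have "V \<inter> S = (\<Union>y\<in>C. mball_of m y (\<delta> y)) \<inter> S" using C \<delta>(2) by blast
  also have "\<dots> \<in> sets (open_ball_algebra m)"
  proof (rule sets.Int[OF sets.countable_UN'[OF C(1)] S])
    show "(\<lambda>y. mball_of m y (\<delta> y)) ` C \<subseteq> sets (open_ball_algebra m)"
      using C(2) Sm by (intro image_subsetI mball_of_in_open_ball_algebra) blast
  qed
  finally have "V \<inter> S \<in> sets (open_ball_algebra m)" .
  moreover have "f -` U \<inter> space (restrict_space (open_ball_algebra m) S) = V \<inter> S"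
    using V(2) Sm by (auto simp: space_restrict_space space_open_ball_algebra)
  ultimately show "f -` U \<inter> space (restrict_space (open_ball_algebra m) S)
      \<in> sets (restrict_space (open_ball_algebra m) S)"
    using S by (simp only: sets_restrict_space_iff sets.Int_space_eq2) blast
qed

lemma borel_measurable_open_ball_algebra:
  fixes f :: "'a \<Rightarrow> 'b::metric_space"
  assumes "f \<in> borel_measurable P"
  shows "f \<in> P \<rightarrow>\<^sub>M open_ball_algebra euclidean_metric"
proof (rule measurable_open_ball_algebraI)
  fix y :: 'b and r
  have "mball_of euclidean_metric y r = ball y r" by auto
  then show "f -` mball_of euclidean_metric y r \<inter> space P \<in> sets P"
    using measurable_sets[OF assms, of "ball y r"] by simp
qed simp

lemma continuous_map_subtopology_metric:
  fixes f :: "'a \<Rightarrow> 'b::metric_space"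
  assumes f: "continuous_map (subtopology (mtopology_of m) S) euclidean f"
    and S: "S \<subseteq> mspace m" and y: "y \<in> S" and "0 < \<eta>"
  shows "\<exists>\<delta>>0. \<forall>z\<in>S. mdist m y z < \<delta> \<longrightarrow> dist (f z) (f y) < \<eta>"
proof -
  interpret Metric_space "mspace m" "mdist m" by (rule Metric_space_mspace_mdist)
  have "openin (subtopology (mtopology_of m) S) {z \<in> S. f z \<in> ball (f y) \<eta>}"
    using openin_continuous_map_preimage[OF f, of "ball (f y) \<eta>"] S by (simp add: inf_absorb2)
  then obtain V where V: "openin (mtopology_of m) V" "{z \<in> S. f z \<in> ball (f y) \<eta>} = V \<inter> S"
    by (auto simp: openin_subtopology)
  have "y \<in> V \<inter> S" unfolding V(2)[symmetric] using y \<open>0 < \<eta>\<close> by simp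
  then obtain r where "r > 0" "mball_of m y r \<subseteq> V"
    using V(1) by (auto simp: mtopology_of_def openin_mtopology mball_of_def)
  moreover have "dist (f z) (f y) < \<eta>" if "z \<in> S" "z \<in> V" for z
  proof -
    have "z \<in> {z \<in> S. f z \<in> ball (f y) \<eta>}" unfolding V(2) using that by simp
    then show ?thesis by (simp add: dist_commute)
  qed
  ultimately show ?thesis using S y by (intro exI[of _ r]) (auto simp: subset_iff)
qed

text \<open>Unlike continuity relative to \<open>S\<close>, this controls \<open>f\<close> at all
  points of the space near \<open>y\<close>. It serves the extended derivative, which is evaluated
  at points outside the separable set.\<close>

lemma topcontinuous_at_metric:
  fixes f :: "'a \<Rightarrow> 'b::metric_space"
  assumes f: "topcontinuous_at (mtopology_of m) euclidean f y" and "0 < \<eta>"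
  shows "\<exists>\<delta>>0. \<forall>z\<in>mspace m. mdist m y z < \<delta> \<longrightarrow> dist (f z) (f y) < \<eta>"
proof -
  interpret Metric_space "mspace m" "mdist m" by (rule Metric_space_mspace_mdist)
  obtain V where V: "openin (mtopology_of m) V" "y \<in> V" "\<And>z. z \<in> V \<Longrightarrow> f z \<in> ball (f y) \<eta>"
    using f \<open>0 < \<eta>\<close> unfolding topcontinuous_at_def
    by (metis centre_in_ball open_ball open_openin)
  then obtain r where "r > 0" "mball_of m y r \<subseteq> V"
    by (auto simp: mtopology_of_def openin_mtopology mball_of_def)
  moreover have "y \<in> mspace m" using f by (simp add: topcontinuous_at_def)
  ultimately show ?thesis
    using V(3) by (intro exI[of _ r]) (auto simp: subset_iff dist_commute)
qed

section \<open>Convergence of expectations from local closeness\<close>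

text \<open>Let \<open>s\<close> be the sum of the weights at a point. Splitting \<open>G\<close>
  into the parts \<open>v i * G\<close> and the rest \<open>(1 - s) * G\<close>, each weight is
  positive only where \<open>G\<close> is within \<eta> of \<open>b i\<close>, and the rest is at
  most \<open>C * (1 - s)\<close>. The bound then follows by integration.\<close>

lemma (in prob_space) integral_near_weighted_sum:
  fixes G :: "'a \<Rightarrow> real" and v :: "'i \<Rightarrow> 'a \<Rightarrow> real"
  assumes G: "G \<in> borel_measurable M" "\<And>\<omega>. \<omega> \<in> space M \<Longrightarrow> \<bar>G \<omega>\<bar> \<le> C"
    and I: "finite I"
    and v: "\<And>i. i \<in> I \<Longrightarrow> v i \<in> borel_measurable M"
      "\<And>i \<omega>. i \<in> I \<Longrightarrow> \<omega> \<in> space M \<Longrightarrow> 0 \<le> v i \<omega>"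
      "\<And>\<omega>. \<omega> \<in> space M \<Longrightarrow> (\<Sum>i\<in>I. v i \<omega>) \<le> 1"
    and close: "\<And>i \<omega>. i \<in> I \<Longrightarrow> \<omega> \<in> space M \<Longrightarrow> 0 < v i \<omega> \<Longrightarrow> \<bar>G \<omega> - b i\<bar> \<le> \<eta>"
    and "0 \<le> \<eta>"
  shows "\<bar>(\<integral>\<omega>. G \<omega> \<partial>M) - (\<integral>\<omega>. (\<Sum>i\<in>I. v i \<omega> * b i) \<partial>M)\<bar>
    \<le> \<eta> + C * (1 - (\<integral>\<omega>. (\<Sum>i\<in>I. v i \<omega>) \<partial>M))"
proof -
  have "v i \<omega> \<le> 1" if "i \<in> I" "\<omega> \<in> space M" for i \<omega>
    using member_le_sum[of i I "\<lambda>i. v i \<omega>"] I v(2,3) that by force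
  then have int_v: "integrable M (v i)" if "i \<in> I" for i
    using v(1,2) that by (intro integrable_const_bound[of _ 1]) (auto intro!: AE_I2)
  have int_G: "integrable M G"
    using G by (intro integrable_const_bound[of _ C]) (auto intro!: AE_I2)
  have pw: "\<bar>G \<omega> - (\<Sum>i\<in>I. v i \<omega> * b i)\<bar> \<le> \<eta> + C * (1 - (\<Sum>i\<in>I. v i \<omega>))"
    if \<omega>: "\<omega> \<in> space M" for \<omega>
  proof -
    let ?s = "\<Sum>i\<in>I. v i \<omega>"
    have "G \<omega> - (\<Sum>i\<in>I. v i \<omega> * b i) = (\<Sum>i\<in>I. v i \<omega> * (G \<omega> - b i)) + (1 - ?s) * G \<omega>"
      by (simp add: right_diff_distrib left_diff_distrib sum_subtractf sum_distrib_right)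
    also have "\<bar>\<dots>\<bar> \<le> \<bar>\<Sum>i\<in>I. v i \<omega> * (G \<omega> - b i)\<bar> + \<bar>(1 - ?s) * G \<omega>\<bar>"
      by (rule abs_triangle_ineq)
    also have "\<bar>\<Sum>i\<in>I. v i \<omega> * (G \<omega> - b i)\<bar> \<le> (\<Sum>i\<in>I. v i \<omega> * \<eta>)"
    proof (intro order_trans[OF sum_abs] sum_mono)
      fix i assume i: "i \<in> I"
      show "\<bar>v i \<omega> * (G \<omega> - b i)\<bar> \<le> v i \<omega> * \<eta>"
        using v(2)[OF i \<omega>] close[OF i \<omega>]
        by (cases "v i \<omega> = 0") (auto simp: abs_mult intro!: mult_left_mono)
    qed
    also have "(\<Sum>i\<in>I. v i \<omega> * \<eta>) \<le> \<eta>"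
      using mult_right_mono[OF v(3)[OF \<omega>] \<open>0 \<le> \<eta>\<close>] by (simp add: sum_distrib_right)
    also have "\<bar>(1 - ?s) * G \<omega>\<bar> \<le> C * (1 - ?s)"
      using mult_left_mono[OF G(2)[OF \<omega>], of "1 - ?s"] v(3)[OF \<omega>] by (simp add: abs_mult mult.commute)
    finally show ?thesis by simp
  qed
  have "(\<integral>\<omega>. G \<omega> \<partial>M) - (\<integral>\<omega>. (\<Sum>i\<in>I. v i \<omega> * b i) \<partial>M)
      = (\<integral>\<omega>. G \<omega> - (\<Sum>i\<in>I. v i \<omega> * b i) \<partial>M)"
    using int_G int_v by (intro Bochner_Integration.integral_diff[symmetric]) auto
  also have "\<bar>\<dots>\<bar> \<le> (\<integral>\<omega>. \<bar>G \<omega> - (\<Sum>i\<in>I. v i \<omega> * b i)\<bar> \<partial>M)"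
    by (rule integral_abs_bound)
  also have "\<dots> \<le> (\<integral>\<omega>. \<eta> + C * (1 - (\<Sum>i\<in>I. v i \<omega>)) \<partial>M)"
    using int_G int_v pw by (intro integral_mono) auto
  also have "\<dots> = \<eta> + C * (1 - (\<integral>\<omega>. (\<Sum>i\<in>I. v i \<omega>) \<partial>M))"
    using int_v by (simp add: prob_space)
  finally show ?thesis .
qed

text \<open>Weak convergence speaks only about functions of \<open>Y n\<close>, whereas
  \<open>F n\<close> may depend on more of the sample point. The bridge is an admissible test
  function \<open>\<phi> k\<close> whose mean is close to those of both \<open>F n\<close> and
  \<open>f (Y0 \<omega>)\<close>, up to the mass that the weights miss. The radius and the index in
  \<open>F_near_f\<close> may vary with the point; uniformity is needed at finitely many centres
  only.\<close>

lemma weak_conv_open_ball_integral_local: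
  fixes F :: "nat \<Rightarrow> 'o \<Rightarrow> real" and f :: "'a \<Rightarrow> real"
  assumes conv: "weak_conv_open_ball m M Y M0 Y0"
    and prob: "\<And>n. prob_space (M n)" and prob0: "prob_space M0"
    and S: "S \<subseteq> mspace m" and sep: "separable_space (subtopology (mtopology_of m) S)"
    and Y0: "Y0 ` space M0 \<subseteq> S"
    and F: "\<And>n. F n \<in> borel_measurable (M n)" "\<And>n \<omega>. \<omega> \<in> space (M n) \<Longrightarrow> \<bar>F n \<omega>\<bar> \<le> C"
    and f: "(\<lambda>\<omega>. f (Y0 \<omega>)) \<in> borel_measurable M0" "\<And>y. y \<in> S \<Longrightarrow> \<bar>f y\<bar> \<le> C"
    and f_cont: "continuous_map (subtopology (mtopology_of m) S) euclideanreal f"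
    and F_near_f: "\<And>y \<eta>. y \<in> S \<Longrightarrow> 0 < \<eta> \<Longrightarrow> \<exists>\<delta>>0. \<exists>n0. \<forall>n\<ge>n0. \<forall>\<omega>\<in>space (M n).
      mdist m y (Y n \<omega>) < \<delta> \<longrightarrow> \<bar>F n \<omega> - f y\<bar> < \<eta>"
  shows "(\<lambda>n. \<integral>\<omega>. F n \<omega> \<partial>M n) \<longlonglongrightarrow> (\<integral>\<omega>. f (Y0 \<omega>) \<partial>M0)"
proof (rule LIMSEQ_I)
  fix e :: real assume "0 < e"
  interpret Metric_space "mspace m" "mdist m" by (rule Metric_space_mspace_mdist)
  interpret M0: prob_space M0 by (rule prob0)
  have mY: "Y n \<in> M n \<rightarrow>\<^sub>M open_ball_algebra m" and mY0: "Y0 \<in> M0 \<rightarrow>\<^sub>M open_ball_algebra m" for n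
    using conv by (auto simp: weak_conv_open_ball_def)
  have conv': "(\<lambda>n. \<integral>\<omega>. g (Y n \<omega>) \<partial>M n) \<longlonglongrightarrow> (\<integral>\<omega>. g (Y0 \<omega>) \<partial>M0)"
    if "continuous_map (mtopology_of m) euclideanreal g" "\<And>y. y \<in> mspace m \<Longrightarrow> \<bar>g y\<bar> \<le> B"
      and g: "g \<in> borel_measurable (open_ball_algebra m)" for g B
  proof -
    have "bounded (g ` mspace m)" using that(2) by (auto simp: bounded_iff)
    then have "(\<lambda>n. \<integral>y. g y \<partial>distr (M n) (open_ball_algebra m) (Y n))
        \<longlonglongrightarrow> (\<integral>y. g y \<partial>distr M0 (open_ball_algebra m) Y0)"
      using conv that(1) g unfolding weak_conv_open_ball_def by blast
    then show ?thesis by (simp add: integral_distr[OF mY g] integral_distr[OF mY0 g])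
  qed
  \<comment> \<open>A probability space is nonempty, so \<open>S\<close> has a point. This gives
    \<open>0 \<le> C\<close> and later a nonempty set of centres to enumerate.\<close>
  obtain \<omega>0 where "\<omega>0 \<in> space M0" using M0.not_empty by blast
  then have "Y0 \<omega>0 \<in> S" using Y0 by blast
  then have C: "0 \<le> C" using f(2) by force
  \<comment> \<open>The final estimate adds three errors \<eta>, two from closeness to the weighted
    sums and one from weak convergence, and two errors \<open>C * \<eta>\<close> from missing
    mass.\<close>
  define \<eta> where "\<eta> = e / (3 + 2 * C)"
  have \<eta>: "0 < \<eta>" using \<open>0 < e\<close> C by (simp add: \<eta>_def)
  have "\<exists>\<delta> n0. 0 < \<delta> \<and> (\<forall>n\<ge>n0. \<forall>\<omega>\<in>space (M n). mdist m y (Y n \<omega>) < \<delta> \<longrightarrow> \<bar>F n \<omega> - f y\<bar> < \<eta>)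
      \<and> (\<forall>z\<in>S. mdist m y z < \<delta> \<longrightarrow> \<bar>f z - f y\<bar> < \<eta>)" if yS: "y \<in> S" for y
  proof -
    obtain \<delta>1 n0 where 1: "0 < \<delta>1" "\<forall>n\<ge>n0. \<forall>\<omega>\<in>space (M n). mdist m y (Y n \<omega>) < \<delta>1 \<longrightarrow> \<bar>F n \<omega> - f y\<bar> < \<eta>"
      using F_near_f[OF yS \<eta>] by blast
    obtain \<delta>2 where 2: "0 < \<delta>2" "\<forall>z\<in>S. mdist m y z < \<delta>2 \<longrightarrow> \<bar>f z - f y\<bar> < \<eta>"
      using continuous_map_subtopology_metric[OF f_cont S yS \<eta>] by (auto simp: dist_real_def)
    show ?thesis using 1 2 by (intro exI[of _ "min \<delta>1 \<delta>2"] exI[of _ n0]) auto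
  qed
  then obtain \<delta> n0 where \<delta>: "\<And>y. y \<in> S \<Longrightarrow> 0 < \<delta> y"
    and near_F: "\<And>y n \<omega>. y \<in> S \<Longrightarrow> n0 y \<le> n \<Longrightarrow> \<omega> \<in> space (M n) \<Longrightarrow> mdist m y (Y n \<omega>) < \<delta> y
      \<Longrightarrow> \<bar>F n \<omega> - f y\<bar> < \<eta>"
    and near_f: "\<And>y z. y \<in> S \<Longrightarrow> z \<in> S \<Longrightarrow> mdist m y z < \<delta> y \<Longrightarrow> \<bar>f z - f y\<bar> < \<eta>"
    by metis
  obtain D where D: "countable D" "D \<subseteq> S" "S \<subseteq> (\<Union>y\<in>D. mball_of m y (\<delta> y))"
    using separable_ball_cover[OF sep S order_refl, of \<delta>] \<delta> by metis
  then have "D \<noteq> {}" using \<open>Y0 \<omega>0 \<in> S\<close> by blast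
  \<comment> \<open>If \<open>D\<close> is finite, the enumeration repeats centres; this is harmless
    because the weights are normalised afterwards.\<close>
  define c where "c = from_nat_into D"
  have range_c: "range c = D"
    unfolding c_def using D(1) \<open>D \<noteq> {}\<close> by (rule range_from_nat_into[rotated])
  then have c: "c i \<in> S" "c i \<in> mspace m" for i using D(2) S by auto
  \<comment> \<open>A tent that, on the space, is positive exactly on the ball around
    \<open>c i\<close> on which the approximation is good.\<close>
  define \<psi> where "\<psi> i y = max 0 (1 - mdist m (c i) y / \<delta> (c i))" for i y
  \<comment> \<open>The cut-off \<open>1 / Suc k\<close> keeps the denominator positive; it is inactive at each point of \<open>S\<close>
    once \<open>k\<close> is large.\<close>
  define w where "w k i y = \<psi> i y / max (1 / real (Suc k)) (\<Sum>j\<le>k. \<psi> j y)" for k i y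
  \<comment> \<open>\<open>W k\<close> is the total weight. It is less than one exactly where the
    sum of the tents lies below the cut-off.\<close>
  define W where "W k y = (\<Sum>i\<le>k. w k i y)" for k y
  define \<phi> where "\<phi> k y = (\<Sum>i\<le>k. w k i y * f (c i))" for k y
  have \<psi>_nonneg: "0 \<le> \<psi> i y" for i y by (simp add: \<psi>_def)
  have max_pos: "0 < max (1 / real (Suc k)) t" for k t by (simp add: less_max_iff_disj)
  have w_nonneg: "0 \<le> w k i y" for k i y
    using \<psi>_nonneg max_pos unfolding w_def by (intro divide_nonneg_pos)
  have W_eq: "W k y = (\<Sum>j\<le>k. \<psi> j y) / max (1 / real (Suc k)) (\<Sum>j\<le>k. \<psi> j y)" for k y
    by (simp add: W_def w_def sum_divide_distrib)
  have W_le: "W k y \<le> 1" for k y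
    unfolding W_eq using max_pos by (subst divide_le_eq_1_pos) auto
  have W_nonneg: "0 \<le> W k y" for k y unfolding W_def by (intro sum_nonneg w_nonneg)
  have near: "mdist m (c i) y < \<delta> (c i)" if "0 < w k i y" for k i y
  proof -
    have "0 < \<psi> i y"
      using that \<psi>_nonneg[of i y] by (cases "\<psi> i y = 0") (auto simp: w_def)
    then show ?thesis using \<delta>[OF c(1)[of i]] by (simp add: \<psi>_def less_max_iff_disj)
  qed
  have w_meas: "w k i \<in> borel_measurable (open_ball_algebra m)" for k i
    using measurable_mdist_open_ball_algebra[OF c(2)] unfolding w_def \<psi>_def by measurable
  have W_meas: "W k \<in> borel_measurable (open_ball_algebra m)" for k
    unfolding W_def using w_meas by measurable
  have \<phi>_meas: "\<phi> k \<in> borel_measurable (open_ball_algebra m)" for k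
    unfolding \<phi>_def using w_meas by measurable
  have \<psi>_cont: "continuous_map (mtopology_of m) euclideanreal (\<psi> i)" for i
    unfolding \<psi>_def using \<delta>[OF c(1)] c(2)
    by (intro continuous_map_real_max continuous_map_diff continuous_map_real_divide
        continuous_map_const[THEN iffD2] continuous_map_mdist) (auto simp: less_imp_neq[symmetric])
  have w_cont: "continuous_map (mtopology_of m) euclideanreal (w k i)" for k i
    unfolding w_def using max_pos \<psi>_cont
    by (intro continuous_map_real_max continuous_map_real_divide continuous_map_sum
        continuous_map_const[THEN iffD2]) (auto simp: less_imp_neq[symmetric])
  have W_cont: "continuous_map (mtopology_of m) euclideanreal (W k)" for k
    unfolding W_def by (intro continuous_map_sum w_cont) auto
  have \<phi>_cont: "continuous_map (mtopology_of m) euclideanreal (\<phi> k)" for k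
    unfolding \<phi>_def by (intro continuous_map_sum continuous_map_real_mult w_cont) auto
  have \<phi>_bound: "\<bar>\<phi> k y\<bar> \<le> C" for k y
  proof -
    have "\<bar>\<phi> k y\<bar> \<le> (\<Sum>i\<le>k. w k i y * C)"
      unfolding \<phi>_def using w_nonneg f(2) c(1)
      by (intro order_trans[OF sum_abs] sum_mono) (auto simp: abs_mult intro!: mult_left_mono)
    also have "\<dots> = W k y * C" by (simp add: W_def sum_distrib_right)
    also have "\<dots> \<le> C" using mult_right_mono[OF W_le C] by simp
    finally show ?thesis .
  qed
  have W_eventually: "\<forall>\<^sub>F k in sequentially. W k y = 1" if "y \<in> S" for y
  proof -
    \<comment> \<open>One centre whose ball contains \<open>y\<close> suffices: its tent bounds the
      sum from below for every later \<open>k\<close>, and the cut-off drops below that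
      bound.\<close>
    obtain j where "y \<in> mball_of m (c j) (\<delta> (c j))" using D(3) \<open>y \<in> S\<close> range_c by blast
    then have j: "0 < \<psi> j y" using \<delta>[OF c(1)[of j]] by (simp add: \<psi>_def)
    then obtain n where n: "1 / real (Suc n) < \<psi> j y" using nat_approx_posE by blast
    have "W k y = 1" if "max j n \<le> k" for k
    proof -
      have "1 / real (Suc k) \<le> 1 / real (Suc n)" using that by (simp add: frac_le)
      also have "\<dots> \<le> \<psi> j y" using n by simp
      also have "\<dots> \<le> (\<Sum>i\<le>k. \<psi> i y)"
        using that \<psi>_nonneg by (intro member_le_sum) auto
      finally have "max (1 / real (Suc k)) (\<Sum>i\<le>k. \<psi> i y) = (\<Sum>i\<le>k. \<psi> i y)" by simp
      then show ?thesis using max_pos[of k "\<Sum>i\<le>k. \<psi> i y"] by (simp add: W_eq)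
    qed
    then show ?thesis unfolding eventually_sequentially by blast
  qed
  \<comment> \<open>The pointwise limit on \<open>S\<close> passes to the mean under
    \<open>Y0\<close>. This fixes a single \<open>k\<close>, hence finitely many centres, before
    \<open>n\<close> grows.\<close>
  have "(\<lambda>k. \<integral>\<omega>. W k (Y0 \<omega>) \<partial>M0) \<longlonglongrightarrow> (\<integral>\<omega>. 1 \<partial>M0)"
  proof (rule integral_dominated_convergence[where w = "\<lambda>_. 1"])
    show "AE \<omega> in M0. (\<lambda>k. W k (Y0 \<omega>)) \<longlonglongrightarrow> 1"
      using W_eventually Y0 by (intro AE_I2 tendsto_eventually) auto
    show "AE \<omega> in M0. norm (W k (Y0 \<omega>)) \<le> 1" for k
      using W_le W_nonneg by (intro AE_I2) auto
    show "(\<lambda>\<omega>. W k (Y0 \<omega>)) \<in> borel_measurable M0" for k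
      using measurable_compose[OF mY0 W_meas] .
  qed auto
  then have "\<forall>\<^sub>F k in sequentially. 1 - \<eta> < (\<integral>\<omega>. W k (Y0 \<omega>) \<partial>M0)"
    using \<eta> by (intro order_tendstoD) (auto simp: M0.prob_space)
  then obtain k where k: "1 - \<eta> < (\<integral>\<omega>. W k (Y0 \<omega>) \<partial>M0)"
    by (auto simp: eventually_sequentially)
  have est0: "\<bar>(\<integral>\<omega>. f (Y0 \<omega>) \<partial>M0) - (\<integral>\<omega>. \<phi> k (Y0 \<omega>) \<partial>M0)\<bar>
      \<le> \<eta> + C * (1 - (\<integral>\<omega>. W k (Y0 \<omega>) \<partial>M0))"
    unfolding \<phi>_def W_def
  proof (rule M0.integral_near_weighted_sum)
    show "\<bar>f (Y0 \<omega>) - f (c i)\<bar> \<le> \<eta>" if "\<omega> \<in> space M0" "0 < w k i (Y0 \<omega>)" for i \<omega>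
      using near_f[OF c(1) _ near[OF that(2)]] Y0 that(1) by (auto intro: less_imp_le)
    show "(\<Sum>i\<le>k. w k i (Y0 \<omega>)) \<le> 1" for \<omega> using W_le by (simp add: W_def)
  qed (use f Y0 \<eta> w_nonneg measurable_compose[OF mY0 w_meas] in auto)
  \<comment> \<open>Only the centres \<open>c 0\<close> to \<open>c k\<close> occur in the sums, so
    their index thresholds have a maximum.\<close>
  define n1 where "n1 = Max (n0 ` c ` {..k})"
  have n1: "n0 (c i) \<le> n" if "i \<le> k" "n \<ge> n1" for i n
  proof -
    have "n0 (c i) \<le> n1" unfolding n1_def using that by (intro Max_ge) auto
    then show ?thesis using that by simp
  qed
  have est: "\<bar>(\<integral>\<omega>. F n \<omega> \<partial>M n) - (\<integral>\<omega>. \<phi> k (Y n \<omega>) \<partial>M n)\<bar>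
      \<le> \<eta> + C * (1 - (\<integral>\<omega>. W k (Y n \<omega>) \<partial>M n))" if "n \<ge> n1" for n
    unfolding \<phi>_def W_def
  proof (rule prob_space.integral_near_weighted_sum[OF prob])
    show "\<bar>F n \<omega> - f (c i)\<bar> \<le> \<eta>" if "i \<in> {..k}" "\<omega> \<in> space (M n)" "0 < w k i (Y n \<omega>)" for i \<omega>
      using near_F[OF c(1) n1 that(2) near[OF that(3)]] that(1) \<open>n \<ge> n1\<close> by (auto intro: less_imp_le)
    show "(\<Sum>i\<le>k. w k i (Y n \<omega>)) \<le> 1" for \<omega> using W_le by (simp add: W_def)
  qed (use F \<eta> w_nonneg measurable_compose[OF mY w_meas] in auto)
  \<comment> \<open>\<open>W k\<close> is itself an admissible test function. Its mean stays above
    \<open>1 - \<eta>\<close> for large \<open>n\<close>, which bounds the missing mass even though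
    \<open>Y n\<close> may leave \<open>S\<close>.\<close>
  have "(\<lambda>n. \<integral>\<omega>. W k (Y n \<omega>) \<partial>M n) \<longlonglongrightarrow> (\<integral>\<omega>. W k (Y0 \<omega>) \<partial>M0)"
    using W_le W_nonneg by (intro conv'[OF W_cont _ W_meas, of _ 1]) auto
  then have ev1: "\<forall>\<^sub>F n in sequentially. 1 - \<eta> < (\<integral>\<omega>. W k (Y n \<omega>) \<partial>M n)"
    using k by (rule order_tendstoD)
  have "(\<lambda>n. \<integral>\<omega>. \<phi> k (Y n \<omega>) \<partial>M n) \<longlonglongrightarrow> (\<integral>\<omega>. \<phi> k (Y0 \<omega>) \<partial>M0)"
    by (rule conv'[OF \<phi>_cont \<phi>_bound \<phi>_meas])
  then have ev2: "\<forall>\<^sub>F n in sequentially.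
      \<bar>(\<integral>\<omega>. \<phi> k (Y n \<omega>) \<partial>M n) - (\<integral>\<omega>. \<phi> k (Y0 \<omega>) \<partial>M0)\<bar> < \<eta>"
    using \<eta> by (auto dest!: tendstoD simp: dist_real_def)
  have "\<forall>\<^sub>F n in sequentially. \<bar>(\<integral>\<omega>. F n \<omega> \<partial>M n) - (\<integral>\<omega>. f (Y0 \<omega>) \<partial>M0)\<bar> < e"
    using ev1 ev2 eventually_ge_at_top[of n1]
  proof eventually_elim
    case (elim n)
    have "C * (1 - (\<integral>\<omega>. W k (Y n \<omega>) \<partial>M n)) \<le> C * \<eta>" "C * (1 - (\<integral>\<omega>. W k (Y0 \<omega>) \<partial>M0)) \<le> C * \<eta>"
      using elim(1) k C by (auto intro!: mult_left_mono)
    then have "\<bar>(\<integral>\<omega>. F n \<omega> \<partial>M n) - (\<integral>\<omega>. f (Y0 \<omega>) \<partial>M0)\<bar> < \<eta> + C * \<eta> + \<eta> + C * \<eta> + \<eta>"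
      using est[OF elim(3)] est0 elim(2) by linarith
    also have "\<dots> = \<eta> * (3 + 2 * C)" by (simp add: algebra_simps)
    also have "\<dots> = e" using C by (simp add: \<eta>_def)
    finally show ?case .
  qed
  then show "\<exists>n2. \<forall>n\<ge>n2. norm ((\<integral>\<omega>. F n \<omega> \<partial>M n) - (\<integral>\<omega>. f (Y0 \<omega>) \<partial>M0)) < e"
    by (simp add: eventually_sequentially)
qed

section \<open>Difference quotients and pairs of random variables\<close>

text \<open>The sequential definition yields local uniformity by contradiction: failure at every
  radius \<open>1 / real (Suc k)\<close> and index \<open>k\<close> provides points
  \<open>v k\<close> and indices \<open>n k\<close> from which a triplet violating differentiability
  is built. As \<open>N\<close> is an arbitrary function here, its nonnegativity at the relevant
  points is supplied as a premise for the sandwich argument.\<close>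

lemma quasi_hadamard_local_uniform:
  assumes d: "has_quasi_hadamard_derivative E N VH H x E0 Hd"
    and a_pos: "\<And>n. 0 < a n" and a_lim: "filterlim a at_top sequentially"
    and y: "y \<in> E0" and "0 < \<eta>"
  shows "\<exists>\<delta>>0. \<exists>n0. \<forall>n\<ge>n0. \<forall>v\<in>VH. a n *\<^sub>R (v - x) \<in> E \<longrightarrow> N (a n *\<^sub>R (v - x) - y) < \<delta> \<longrightarrow>
    0 \<le> N (a n *\<^sub>R (v - x) - y) \<longrightarrow> norm (a n *\<^sub>R (H v - H x) - Hd y) < \<eta>"
proof (rule ccontr)
  assume neg: "\<not> ?thesis"
  let ?P = "\<lambda>k n v. n \<ge> k \<and> v \<in> VH \<and> a n *\<^sub>R (v - x) \<in> E \<and>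
    N (a n *\<^sub>R (v - x) - y) < 1 / real (Suc k) \<and>
    0 \<le> N (a n *\<^sub>R (v - x) - y) \<and> \<eta> \<le> norm (a n *\<^sub>R (H v - H x) - Hd y)"
  have "\<exists>n v. ?P k n v" for k
  proof -
    have "1 / real (Suc k) > 0" by simp
    then show ?thesis using neg by (meson not_less)
  qed
  then obtain n v where nv: "\<And>k. ?P k (n k) (v k)" by metis
  \<comment> \<open>The bound \<open>k \<le> n k\<close> already forces divergence, so no monotone
    subsequence has to be extracted.\<close>
  have n_lim: "filterlim n at_top sequentially"
    by (rule filterlim_at_top_mono[OF filterlim_ident]) (use nv in auto)
  \<comment> \<open>The triplet is chosen so that \<open>x + \<epsilon> k *\<^sub>R xs k\<close> is
    \<open>v k\<close> again and the difference quotient has the factor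
    \<open>a (n k)\<close>.\<close>
  define \<epsilon> where "\<epsilon> k = inverse (a (n k))" for k
  define xs where "xs k = a (n k) *\<^sub>R (v k - x)" for k
  have \<epsilon>_lim: "\<epsilon> \<longlonglongrightarrow> 0"
    unfolding \<epsilon>_def using filterlim_compose[OF a_lim n_lim] by (rule tendsto_inverse_0_at_top)
  have \<epsilon>_pos: "0 < \<epsilon> k" for k using a_pos by (simp add: \<epsilon>_def)
  have v: "x + \<epsilon> k *\<^sub>R xs k = v k" for k
    using a_pos[of "n k"] by (simp add: \<epsilon>_def xs_def)
  have "(\<lambda>k. N (xs k - y)) \<longlonglongrightarrow> 0"
    by (rule tendsto_sandwich[OF _ _ tendsto_const LIMSEQ_inverse_real_of_nat])
      (use nv in \<open>auto simp: xs_def field_simps intro!: always_eventually less_imp_le\<close>)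
  moreover have "xs k \<in> E" "x + \<epsilon> k *\<^sub>R xs k \<in> VH" for k
    using nv v by (auto simp: xs_def)
  ultimately have "(\<lambda>k. norm (Hd y - inverse (\<epsilon> k) *\<^sub>R (H (x + \<epsilon> k *\<^sub>R xs k) - H x))) \<longlonglongrightarrow> 0"
    using d y \<epsilon>_lim \<epsilon>_pos unfolding has_quasi_hadamard_derivative_def by blast
  then obtain k where "norm (Hd y - a (n k) *\<^sub>R (H (v k) - H x)) < \<eta>"
    using \<open>0 < \<eta>\<close> v by (auto simp: \<epsilon>_def dest!: LIMSEQ_D)
  then show False using nv[of k] by (simp add: norm_minus_commute)
qed

text \<open>A ball of the maximum metric is a product of two balls of equal radius, so its preimage
  is an intersection of two measurable sets.\<close>

lemma measurable_Pair_max_metric: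
  fixes f g :: "'a \<Rightarrow> 'w::metric_space"
  assumes f: "f \<in> P \<rightarrow>\<^sub>M open_ball_algebra euclidean_metric"
    and g: "g \<in> P \<rightarrow>\<^sub>M open_ball_algebra euclidean_metric"
  shows "(\<lambda>\<omega>. (f \<omega>, g \<omega>)) \<in> P \<rightarrow>\<^sub>M open_ball_algebra max_metric"
proof (rule measurable_open_ball_algebraI)
  fix p :: "'w \<times> 'w" and r
  obtain u v where p: "p = (u, v)" by (cases p)
  have "(\<lambda>\<omega>. (f \<omega>, g \<omega>)) -` mball_of max_metric p r \<inter> space P
      = (f -` mball_of euclidean_metric u r \<inter> space P) \<inter> (g -` mball_of euclidean_metric v r \<inter> space P)"
    by (auto simp: p mspace_max_metric mdist_max_metric)
  also have "\<dots> \<in> sets P"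
    by (intro sets.Int measurable_sets[OF f] measurable_sets[OF g] mball_of_in_open_ball_algebra) simp_all
  finally show "(\<lambda>\<omega>. (f \<omega>, g \<omega>)) -` mball_of max_metric p r \<inter> space P \<in> sets P" .
qed (simp add: mspace_max_metric)

section \<open>Convergence in law and in probability of the transformed variables\<close>

theorem theoremC4:
  fixes E E0 VH :: "'v::real_vector set"
    and N :: "'v \<Rightarrow> real"
    and H Hd :: "'v \<Rightarrow> 'w::real_normed_vector"
    and x :: 'v
    and M :: "nat \<Rightarrow> 'o measure"
    and X :: "nat \<Rightarrow> 'o \<Rightarrow> 'v"
    and M0 :: "'p measure"
    and X0 :: "'p \<Rightarrow> 'v"
    and a :: "nat \<Rightarrow> real"
  assumes norm: "norm_on_subspace E N"
    and x: "x \<in> VH"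
    and E0: "E0 \<in> sets (open_ball_algebra (subspace_metric E N))"
    and E0_separable: "separable_space (subtopology (mtopology_of (subspace_metric E N)) E0)"
    and prob: "\<And>n. prob_space (M n)"
    and a_pos: "\<And>n. 0 < a n"
    and a_lim: "filterlim a at_top sequentially"
    and cond_a: "\<And>n. X n \<in> space (M n) \<rightarrow> VH"
    and cond_b_values: "\<And>n \<omega>. \<omega> \<in> space (M n) \<Longrightarrow> a n *\<^sub>R (X n \<omega> - x) \<in> E"
    and cond_b_measurable:
      "\<And>n. (\<lambda>\<omega>. a n *\<^sub>R (X n \<omega> - x)) \<in> M n \<rightarrow>\<^sub>M open_ball_algebra (subspace_metric E N)"
    and cond_b_prob: "prob_space M0"
    and cond_b_limit_measurable: "X0 \<in> M0 \<rightarrow>\<^sub>M open_ball_algebra (subspace_metric E N)"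
    and cond_b_limit_values: "X0 ` space M0 \<subseteq> E0"
    and cond_b_conv:
      "weak_conv_open_ball (subspace_metric E N) M (\<lambda>n \<omega>. a n *\<^sub>R (X n \<omega> - x)) M0 X0"
    and cond_c:
      "\<And>n. (\<lambda>\<omega>. a n *\<^sub>R (H (X n \<omega>) - H x)) \<in> M n \<rightarrow>\<^sub>M open_ball_algebra euclidean_metric"
    and cond_d: "has_quasi_hadamard_derivative E N VH H x E0 Hd"
  shows
    "((\<lambda>\<omega>. Hd (X0 \<omega>)) \<in> M0 \<rightarrow>\<^sub>M open_ball_algebra euclidean_metric \<and>
      weak_conv_open_ball euclidean_metric M
        (\<lambda>n \<omega>. a n *\<^sub>R (H (X n \<omega>) - H x)) M0 (\<lambda>\<omega>. Hd (X0 \<omega>))) \<and>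
     (\<forall>P Hext.
        (\<forall>n. M n = P) \<longrightarrow>
        (\<forall>y\<in>E0. Hext y = Hd y) \<and>
        (\<forall>y\<in>E0. topcontinuous_at (mtopology_of (subspace_metric E N)) euclidean Hext y) \<and>
        Hext \<in> open_ball_algebra (subspace_metric E N) \<rightarrow>\<^sub>M open_ball_algebra euclidean_metric \<longrightarrow>
        (\<lambda>(y1, y2). y1 - y2 :: 'w) \<in> open_ball_algebra max_metric
          \<rightarrow>\<^sub>M open_ball_algebra euclidean_metric \<longrightarrow>
        conv_in_prob_open_ball euclidean_metric P
          (\<lambda>n \<omega>. a n *\<^sub>R (H (X n \<omega>) - H x) - Hext (a n *\<^sub>R (X n \<omega> - x)))
          (\<lambda>\<omega>. 0))"
proof (intro conjI allI impI)
  let ?m = "subspace_metric E N"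
  define Y where "Y n \<omega> = a n *\<^sub>R (X n \<omega> - x)" for n \<omega>
  define Z where "Z n \<omega> = a n *\<^sub>R (H (X n \<omega>) - H x)" for n \<omega>
  note mspace = mspace_subspace_metric[OF norm]
  have E0_sub: "E0 \<subseteq> mspace ?m"
    using sets.sets_into_space[OF E0] by (simp add: space_open_ball_algebra)
  have Hd_cont: "continuous_map (subtopology (mtopology_of ?m) E0) euclidean Hd"
    using cond_d by (simp add: has_quasi_hadamard_derivative_def)
  \<comment> \<open>\<open>Hd\<close> is controlled only on \<open>E0\<close>, so \<open>X0\<close>
    is first viewed as a map into the restricted space; separability of \<open>E0\<close> then makes
    the composition Borel measurable.\<close>
  have "X0 \<in> M0 \<rightarrow>\<^sub>M restrict_space (open_ball_algebra ?m) E0"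
    using cond_b_limit_measurable cond_b_limit_values by (intro measurable_restrict_space2) auto
  then have HdX0: "(\<lambda>\<omega>. Hd (X0 \<omega>)) \<in> borel_measurable M0"
    by (rule measurable_compose) (rule continuous_on_separable_measurable[OF E0_separable E0 Hd_cont])
  then show HdX0': "(\<lambda>\<omega>. Hd (X0 \<omega>)) \<in> M0 \<rightarrow>\<^sub>M open_ball_algebra euclidean_metric"
    by (rule borel_measurable_open_ball_algebra)
  have conv: "weak_conv_open_ball ?m M Y M0 X0"
    using cond_b_conv by (simp add: Y_def[abs_def])
  have Y_in: "Y n \<omega> \<in> mspace ?m" if "\<omega> \<in> space (M n)" for n \<omega>
    using cond_b_values[OF that] by (simp add: Y_def mspace)
  have mY: "Y n \<in> M n \<rightarrow>\<^sub>M open_ball_algebra ?m" for n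
    using cond_b_measurable[of n] by (simp add: Y_def[abs_def])
  have mZ: "Z n \<in> M n \<rightarrow>\<^sub>M open_ball_algebra euclidean_metric" for n
    using cond_c[of n] by (simp add: Z_def[abs_def])
  \<comment> \<open>The differentiability estimate is deterministic: applied with
    \<open>X n \<omega>\<close> for \<open>v\<close>, one radius and one index serve all sample
    points.\<close>
  have Z_near: "\<exists>\<delta>>0. \<exists>n0. \<forall>n\<ge>n0. \<forall>\<omega>\<in>space (M n).
      mdist ?m y (Y n \<omega>) < \<delta> \<longrightarrow> dist (Z n \<omega>) (Hd y) < \<eta>" if y: "y \<in> E0" and \<eta>: "0 < \<eta>" for y \<eta>
  proof -
    obtain \<delta> n0 where "0 < \<delta>" and \<delta>: "\<And>n v. n0 \<le> n \<Longrightarrow> v \<in> VH \<Longrightarrow> a n *\<^sub>R (v - x) \<in> E \<Longrightarrow>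
        N (a n *\<^sub>R (v - x) - y) < \<delta> \<Longrightarrow> 0 \<le> N (a n *\<^sub>R (v - x) - y) \<Longrightarrow>
        norm (a n *\<^sub>R (H v - H x) - Hd y) < \<eta>"
      using quasi_hadamard_local_uniform[OF cond_d a_pos a_lim y \<eta>] by blast
    have "dist (Z n \<omega>) (Hd y) < \<eta>"
      if "n0 \<le> n" "\<omega> \<in> space (M n)" "mdist ?m y (Y n \<omega>) < \<delta>" for n \<omega>
    proof -
      \<comment> \<open>The metric agrees with \<open>N\<close> of the difference only for points of
        \<open>E\<close>, and symmetry accounts for the exchanged arguments.\<close>
      have "N (Y n \<omega> - y) = mdist ?m y (Y n \<omega>)"
        using mdist_subspace_metric[OF norm, of "Y n \<omega>" y] Y_in[OF that(2)] y E0_sub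
          Metric_space.commute[OF Metric_space_mspace_mdist] by (metis mspace subsetD)
      moreover have "0 \<le> mdist ?m y (Y n \<omega>)"
        by (rule Metric_space.nonneg[OF Metric_space_mspace_mdist])
      ultimately show ?thesis
        using \<delta>[OF that(1), of "X n \<omega>"] cond_a[of n] cond_b_values[OF that(2)] that(2,3)
        by (auto simp: Y_def Z_def dist_norm)
    qed
    then show ?thesis using \<open>0 < \<delta>\<close> by blast
  qed
  show "weak_conv_open_ball euclidean_metric M (\<lambda>n \<omega>. a n *\<^sub>R (H (X n \<omega>) - H x)) M0 (\<lambda>\<omega>. Hd (X0 \<omega>))"
    unfolding weak_conv_open_ball_def Z_def[symmetric]
  proof (intro conjI allI impI mZ HdX0')
    fix g :: "'w \<Rightarrow> real"
    assume "continuous_map (mtopology_of euclidean_metric) euclideanreal g"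
      and "bounded (g ` mspace euclidean_metric)"
      and g: "g \<in> borel_measurable (open_ball_algebra euclidean_metric)"
    then have g_cont: "continuous_on UNIV g" and "bounded (range g)" by auto
    then obtain C where C: "\<And>u. \<bar>g u\<bar> \<le> C" by (auto simp: bounded_iff)
    have "(\<lambda>n. \<integral>\<omega>. g (Z n \<omega>) \<partial>M n) \<longlonglongrightarrow> (\<integral>\<omega>. g (Hd (X0 \<omega>)) \<partial>M0)"
    proof (rule weak_conv_open_ball_integral_local[OF conv prob cond_b_prob E0_sub E0_separable
          cond_b_limit_values, where f = "\<lambda>y. g (Hd y)"])
      show "(\<lambda>\<omega>. g (Z n \<omega>)) \<in> borel_measurable (M n)" for n
        by (rule measurable_compose[OF mZ g])
      show "(\<lambda>\<omega>. g (Hd (X0 \<omega>))) \<in> borel_measurable M0"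
        by (rule measurable_compose[OF HdX0' g])
      show "continuous_map (subtopology (mtopology_of ?m) E0) euclideanreal (\<lambda>y. g (Hd y))"
        using continuous_map_compose[OF Hd_cont, of euclideanreal g] g_cont by (simp add: o_def)
      show "\<exists>\<delta>>0. \<exists>n0. \<forall>n\<ge>n0. \<forall>\<omega>\<in>space (M n).
          mdist ?m y (Y n \<omega>) < \<delta> \<longrightarrow> \<bar>g (Z n \<omega>) - g (Hd y)\<bar> < \<eta>" if y: "y \<in> E0" and "0 < \<eta>" for y \<eta>
      proof -
        \<comment> \<open>Continuity of \<open>g\<close> at the single value \<open>Hd y\<close>
          turns closeness of \<open>Z n\<close> into closeness of
          \<open>g (Z n \<omega>)\<close>.\<close>
        obtain \<eta>' where "0 < \<eta>'" "\<And>u. dist u (Hd y) < \<eta>' \<Longrightarrow> \<bar>g u - g (Hd y)\<bar> < \<eta>"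
          using g_cont \<open>0 < \<eta>\<close> unfolding continuous_on_iff dist_real_def by blast
        then show ?thesis using Z_near[OF y] by meson
      qed
    qed (use C in auto)
    then show "(\<lambda>n. \<integral>u. g u \<partial>distr (M n) (open_ball_algebra euclidean_metric) (Z n))
        \<longlonglongrightarrow> (\<integral>u. g u \<partial>distr M0 (open_ball_algebra euclidean_metric) (\<lambda>\<omega>. Hd (X0 \<omega>)))"
      by (simp add: integral_distr[OF mZ g] integral_distr[OF HdX0' g])
  qed
  fix P and Hext :: "'v \<Rightarrow> 'w"
  assume MP: "\<forall>n. M n = P"
    and Hext: "(\<forall>y\<in>E0. Hext y = Hd y) \<and>
      (\<forall>y\<in>E0. topcontinuous_at (mtopology_of ?m) euclidean Hext y) \<and>
      Hext \<in> open_ball_algebra ?m \<rightarrow>\<^sub>M open_ball_algebra euclidean_metric"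
    and diff: "(\<lambda>(y1, y2). y1 - y2 :: 'w) \<in> open_ball_algebra max_metric
      \<rightarrow>\<^sub>M open_ball_algebra euclidean_metric"
  define R where "R n \<omega> = Z n \<omega> - Hext (Y n \<omega>)" for n \<omega>
  have M_eq: "M n = P" for n using MP by simp
  interpret P: prob_space P using prob M_eq by metis
  \<comment> \<open>Measurability of a difference is not automatic for open-ball sigma-algebras: the
    pair is measurable for the maximum metric, and then the assumed measurability of subtraction
    applies.\<close>
  have mR: "R n \<in> P \<rightarrow>\<^sub>M open_ball_algebra euclidean_metric" for n
    using measurable_compose[OF measurable_Pair_max_metric[OF mZ[of n] measurable_compose[OF mY]] diff] Hext
    by (simp add: R_def[abs_def] M_eq)
  have norm_R: "(\<lambda>\<omega>. norm (R n \<omega>)) \<in> borel_measurable P" for n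
    using measurable_compose[OF mR measurable_mdist_open_ball_algebra[of 0 euclidean_metric]] by simp
  \<comment> \<open>Near \<open>y\<close>, both \<open>Z n\<close> and the extended derivative at
    \<open>Y n\<close> are within half of \<eta> of the common value \<open>Hd y\<close>, so their
    difference is small.\<close>
  have R_near: "\<exists>\<delta>>0. \<exists>n0. \<forall>n\<ge>n0. \<forall>\<omega>\<in>space (M n). mdist ?m y (Y n \<omega>) < \<delta> \<longrightarrow> norm (R n \<omega>) < \<eta>"
    if y: "y \<in> E0" and \<eta>: "0 < \<eta>" for y \<eta>
  proof -
    obtain \<delta>1 n0 where 1: "0 < \<delta>1" "\<And>n \<omega>. n0 \<le> n \<Longrightarrow> \<omega> \<in> space (M n) \<Longrightarrow>
        mdist ?m y (Y n \<omega>) < \<delta>1 \<Longrightarrow> dist (Z n \<omega>) (Hd y) < \<eta> / 2"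
      using Z_near[OF y half_gt_zero[OF \<eta>]] by blast
    obtain \<delta>2 where 2: "0 < \<delta>2" "\<And>z. z \<in> mspace ?m \<Longrightarrow> mdist ?m y z < \<delta>2 \<Longrightarrow>
        dist (Hext z) (Hd y) < \<eta> / 2"
      using topcontinuous_at_metric[of ?m Hext y "\<eta> / 2"] Hext y \<eta> by auto
    have "norm (R n \<omega>) < \<eta>"
      if "n0 \<le> n" "\<omega> \<in> space (M n)" "mdist ?m y (Y n \<omega>) < min \<delta>1 \<delta>2" for n \<omega>
      using dist_triangle_half_l[OF 1(2) 2(2)] Y_in that by (simp add: R_def dist_norm[symmetric])
    then show ?thesis using 1(1) 2(1) by (intro exI[of _ "min \<delta>1 \<delta>2"] conjI) auto
  qed
  have prob_lim: "(\<lambda>n. measure P {\<omega> \<in> space P. \<epsilon> \<le> norm (R n \<omega>)}) \<longlonglongrightarrow> 0" if \<epsilon>: "0 < \<epsilon>" for \<epsilon>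
  proof -
    let ?A = "\<lambda>n. {\<omega> \<in> space P. \<epsilon> \<le> norm (R n \<omega>)}"
    have A: "?A n \<in> sets P" for n using norm_R by measurable
    \<comment> \<open>The probability is written as the mean of an indicator. Locally at each point
      of \<open>E0\<close> this indicator is exactly zero for large \<open>n\<close>, whatever the
      tolerance \<eta>.\<close>
    have "(\<lambda>n. \<integral>\<omega>. indicat_real (?A n) \<omega> \<partial>M n) \<longlonglongrightarrow> (\<integral>\<omega>. 0 \<partial>M0)"
    proof (rule weak_conv_open_ball_integral_local[OF conv prob cond_b_prob E0_sub E0_separable
          cond_b_limit_values, where f = "\<lambda>_. 0" and C = 1])
      show "indicat_real (?A n) \<in> borel_measurable (M n)" for n
        using A by (simp add: M_eq)
      show "\<exists>\<delta>>0. \<exists>n0. \<forall>n\<ge>n0. \<forall>\<omega>\<in>space (M n).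
          mdist ?m y (Y n \<omega>) < \<delta> \<longrightarrow> \<bar>indicat_real (?A n) \<omega> - 0\<bar> < \<eta>" if y: "y \<in> E0" and "0 < \<eta>" for y \<eta>
      proof -
        obtain \<delta> n0 where "0 < \<delta>" and \<delta>: "\<And>n \<omega>. n0 \<le> n \<Longrightarrow> \<omega> \<in> space (M n) \<Longrightarrow>
            mdist ?m y (Y n \<omega>) < \<delta> \<Longrightarrow> norm (R n \<omega>) < \<epsilon>"
          using R_near[OF y \<epsilon>] by blast
        have "indicat_real (?A n) \<omega> = 0"
          if "n0 \<le> n" "\<omega> \<in> space (M n)" "mdist ?m y (Y n \<omega>) < \<delta>" for n \<omega>
          using \<delta>[OF that] by simp
        then show ?thesis using \<open>0 < \<delta>\<close> \<open>0 < \<eta>\<close> by (intro exI[of _ \<delta>] conjI exI[of _ n0]) auto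
      qed
    qed (auto simp: indicator_def)
    then show ?thesis using A by (simp add: M_eq)
  qed
  have "conv_in_prob_open_ball euclidean_metric P R (\<lambda>_. 0)"
    unfolding conv_in_prob_open_ball_def mdist_euclidean_metric dist_0_norm dist_norm diff_zero
  proof (intro conjI allI impI mR prob_lim)
    show "(\<lambda>_. 0) \<in> P \<rightarrow>\<^sub>M open_ball_algebra euclidean_metric"
      by (intro measurable_const) (simp add: space_open_ball_algebra)
    show "(\<lambda>\<omega>. norm (R n \<omega>)) \<in> P \<rightarrow>\<^sub>M restrict_space borel {0..}" for n
      using norm_R by (intro measurable_restrict_space2) auto
  qed
  then show "conv_in_prob_open_ball euclidean_metric P
      (\<lambda>n \<omega>. a n *\<^sub>R (H (X n \<omega>) - H x) - Hext (a n *\<^sub>R (X n \<omega> - x))) (\<lambda>\<omega>. 0)"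
    by (simp add: R_def[abs_def] Y_def Z_def)
qed

end
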